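(* Let $\Delta\ge 3$ be an integer. For each of the $2^{\Delta-1}$ choices of symbols $\circledast_1,\dots,\circledast_{\Delta-1}\in\{=,>\}$ there exists a tree $T$ with maximum degree $\Delta$ such that $$\gamma_{11}(T)\ \circledast_1\ \gamma_{12}(T)\ \circledast_2\ \gamma_{13}(T)\ \cdots\ \gamma_{1(\Delta-1)}(T)\ \circledast_{\Delta-1}\ \gamma_{1\Delta}(T)=\gamma(T),$$ i.e. for every $i\in\{1,\dots,\Delta-1\}$, $\gamma_{1i}(T)=\gamma_{1(i+1)}(T)$ if $\circledast_i$ is "$=$", and $\gamma_{1i}(T)>\gamma_{1(i+1)}(T)$ if $\circledast_i$ is "$>$".
   Context: All graphs are finite, undirected, simple and connected; a tree is a connected acyclic graph. A set $S$ of vertices of a graph $G$ is a dominating set if every vertex not in $S$ is adjacent to at least one vertex of $S$; $\gamma(G)$ is the minimum cardinality of a dominating set. For an integer $k\ge 1$, a $k$-quasiperfect dominating set of $G$ is a dominating set $S$ such that every vertex not in $S$ is adjacent to at most $k$ vertices of $S$; $\gamma_{1k}(G)$ is the minimum cardinality of such a set. *)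

theory Defs
  imports "Graph_Theory.Graph_Theory"
begin

text \<open>
  A finite simple undirected graph is a \<^locale>\<open>pair_graph\<close>, i.e. a finite, loop-free, symmetric
  digraph on a set of vertices. Each undirected edge is represented by two opposite arcs, so the
  arc list \<open>[(a, b), (b, a)]\<close> is a \<^const>\<open>pre_digraph.cycle\<close>. Every longer cycle has
  pairwise distinct vertices and is a cycle of the undirected graph, whence the length bound below.
  (\<^const>\<open>Digraph_Component.tree\<close> forbids all directed cycles, so it fails for every
  symmetric digraph with an arc.)
\<close>

definition undirected_tree :: "'a pair_pre_digraph \<Rightarrow> bool" where
  "undirected_tree G \<longleftrightarrow>
     pair_graph G \<and> Digraph_Component.connected (with_proj G) \<and>
     \<not> (\<exists>p. pre_digraph.cycle (with_proj G) p \<and> 3 \<le> length p)"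

text \<open>By symmetry, the out-degree of a vertex is its undirected degree.\<close>

definition max_degree :: "'a pair_pre_digraph \<Rightarrow> nat" where
  "max_degree G = Max (out_degree (with_proj G) ` pverts G)"

definition dominating_set :: "'a pair_pre_digraph \<Rightarrow> 'a set \<Rightarrow> bool" where
  "dominating_set G S \<longleftrightarrow>
     S \<subseteq> pverts G \<and> (\<forall>v \<in> pverts G - S. \<exists>u \<in> S. (v, u) \<in> parcs G)"

definition quasiperfect_dominating_set :: "nat \<Rightarrow> 'a pair_pre_digraph \<Rightarrow> 'a set \<Rightarrow> bool" where
  "quasiperfect_dominating_set k G S \<longleftrightarrow>
     dominating_set G S \<and> (\<forall>v \<in> pverts G - S. card {u \<in> S. (v, u) \<in> parcs G} \<le> k)"

text \<open>
  On a finite graph both minima below are attained, since the set of all vertices is a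
  \<open>k\<close>-quasiperfect dominating set for every \<open>k\<close>.
\<close>

definition domination_number :: "'a pair_pre_digraph \<Rightarrow> nat" where
  "domination_number G = (LEAST n. \<exists>S. dominating_set G S \<and> card S = n)"

definition quasiperfect_domination_number :: "nat \<Rightarrow> 'a pair_pre_digraph \<Rightarrow> nat" where
  "quasiperfect_domination_number k G =
     (LEAST n. \<exists>S. quasiperfect_dominating_set k G S \<and> card S = n)"

end

theory Submission
  imports Defs
begin

text \<open>
  Let \<open>w\<close> be adjacent to \<open>e + 1\<close> support vertices, each with two further leaves. A minimum dominating
  set contains all these supports, so \<open>w\<close> has \<open>e + 1\<close> dominators; if at most \<open>k \<le> e\<close> are allowed,
  one more vertex is needed, either \<open>w\<close> itself or because a support is replaced by its leaves.
  Hang one such gadget for every \<open>e\<close> with \<open>\<circledast>\<^sub>e\<close> equal to \<open>>\<close> along a spine that makes the costs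
  additive, starting from a star with a vertex of degree \<open>\<Delta>\<close>. Then \<open>\<gamma>\<^sub>1\<^sub>k\<close> is a constant plus the
  number of gadgets with \<open>e \<ge> k\<close>. The costs are computed by dynamic programming on rooted trees.
\<close>

section \<open>Rooted trees as graphs on intervals of natural numbers\<close>

text \<open>\<open>Graft s t\<close> makes the root of \<open>t\<close> a new child of the root of \<open>s\<close>.\<close>

datatype rtree = Vertex | Graft rtree rtree

primrec order :: "rtree \<Rightarrow> nat" where
  "order Vertex = 1"
| "order (Graft s t) = order s + order t"

text \<open>Vertices are numbered consecutively from \<open>n\<close>, root first, the block of
  \<open>s\<close> before that of \<open>t\<close>; thus every child has a larger number than its
  parent.\<close>

primrec tree_arcs :: "rtree \<Rightarrow> nat \<Rightarrow> nat rel" where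
  "tree_arcs Vertex n = {}"
| "tree_arcs (Graft s t) n =
     tree_arcs s n \<union> tree_arcs t (n + order s) \<union> {(n, n + order s), (n + order s, n)}"

abbreviation tree_verts :: "rtree \<Rightarrow> nat \<Rightarrow> nat set" where
  "tree_verts t n \<equiv> {n..<n + order t}"

definition tree_graph :: "rtree \<Rightarrow> nat pair_pre_digraph" where
  "tree_graph t = \<lparr>pverts = tree_verts t 0, parcs = tree_arcs t 0\<rparr>"

lemma tree_graph_simps [simp]:
  "pverts (tree_graph t) = tree_verts t 0"
  "parcs (tree_graph t) = tree_arcs t 0"
  by (simp_all add: tree_graph_def)

lemma order_pos [simp]: "order t \<noteq> 0" "0 < order t"
  by (induction t) auto

lemma tree_arcs_subset: "tree_arcs t n \<subseteq> tree_verts t n \<times> tree_verts t n"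
proof (induction t arbitrary: n)
  case (Graft s t)
  have "order s \<noteq> 0" "order t \<noteq> 0" by simp_all
  with Graft(1)[of n] Graft(2)[of "n + order s"] show ?case by fastforce
qed simp

lemma tree_arcsD:
  assumes "(u, v) \<in> tree_arcs t n"
  shows "n \<le> u" "u < n + order t" "n \<le> v" "v < n + order t"
  using tree_arcs_subset[of t n] assms by auto

lemma finite_tree_arcs: "finite (tree_arcs t n)"
  by (rule finite_subset[OF tree_arcs_subset]) simp

lemma tree_arcs_disjoint: "(v, x) \<in> tree_arcs s n \<Longrightarrow> (v, y) \<notin> tree_arcs t (n + order s)"
  using tree_arcsD(2)[of v x s n] tree_arcsD(1)[of v y t "n + order s"] by auto

lemma tree_arcs_irrefl: "(u, v) \<in> tree_arcs t n \<Longrightarrow> u \<noteq> v"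
  by (induction t arbitrary: n) auto

lemma tree_arcs_sym: "(u, v) \<in> tree_arcs t n \<Longrightarrow> (v, u) \<in> tree_arcs t n"
  by (induction t arbitrary: n) auto

section \<open>Connectedness and acyclicity\<close>

lemma smaller_neighbour_exists:
  "v \<in> tree_verts t n \<Longrightarrow> v \<noteq> n \<Longrightarrow> \<exists>u<v. (u, v) \<in> tree_arcs t n"
proof (induction t arbitrary: n)
  case (Graft s t)
  consider "v \<in> tree_verts s n" | "v \<in> tree_verts t (n + order s)" "v \<noteq> n + order s" | "v = n + order s"
    using Graft.prems by fastforce
  then show ?case
  proof cases
    case 1
    then show ?thesis using Graft.IH(1)[of n] Graft.prems by auto
  next
    case 2
    then show ?thesis using Graft.IH(2)[of "n + order s"] by auto
  next
    case 3
    then show ?thesis by (auto intro!: exI[of _ n])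
  qed
qed simp

text \<open>The only smaller neighbour is the parent, since numbers grow from parent to
  child.\<close>

lemma smaller_neighbour_unique:
  "(v, u) \<in> tree_arcs t n \<Longrightarrow> (v, u') \<in> tree_arcs t n \<Longrightarrow> u < v \<Longrightarrow> u' < v \<Longrightarrow> u = u'"
proof (induction t arbitrary: n)
  case (Graft s t)
  then show ?case
    by (auto dest: tree_arcsD tree_arcs_disjoint)
qed simp

lemma pair_graph_tree_graph: "pair_graph (tree_graph t)"
  by unfold_locales
    (use tree_arcs_subset[of t 0] in \<open>auto simp: finite_tree_arcs symmetric_def sym_def
      dest: tree_arcs_irrefl tree_arcs_sym\<close>)

lemma connected_tree_graph: "Digraph_Component.connected (with_proj (tree_graph t))"
proof -
  let ?G = "with_proj (tree_graph t)"
  interpret pair_graph "tree_graph t" by (rule pair_graph_tree_graph)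
  \<comment> \<open>Induction on the number of the vertex: its parent has a smaller one.\<close>
  have root: "0 \<rightarrow>\<^sup>*\<^bsub>?G\<^esub> v" if "v \<in> tree_verts t 0" for v
    using that
  proof (induction v rule: less_induct)
    case (less v)
    show ?case
    proof (cases "v = 0")
      case False
      then obtain u where u: "u < v" "(u, v) \<in> tree_arcs t 0"
        using smaller_neighbour_exists less.prems by blast
      then have "0 \<rightarrow>\<^sup>*\<^bsub>?G\<^esub> u"
        using less by auto
      then show ?thesis
        using u(2) by (auto intro: reachable_adj_trans)
    qed (use less.prems in auto)
  qed
  have "u \<rightarrow>\<^sup>*\<^bsub>?G\<^esub> v" if "u \<in> tree_verts t 0" "v \<in> tree_verts t 0" for u v
    using root that symmetric_reachable[OF sym_arcs] reachable_trans by blast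
  then show ?thesis
    unfolding connected_def
    by (auto simp: strongly_connected_def reachable_mk_symmetric_eq[OF sym_arcs])
qed

lemma pcas_nth:
  assumes "pcas u p v" "i < length p"
  shows "fst (p ! i) = (if i = 0 then u else snd (p ! (i - 1)))"
  using assms by (induction u p v arbitrary: i rule: pcas.induct) (auto simp: nth_Cons split: nat.splits)

lemma pcas_last:
  assumes "pcas u p v" "p \<noteq> []"
  shows "snd (last p) = v"
  using assms by (induction u p v rule: pcas.induct) (auto split: if_splits)

text \<open>The largest vertex of a cycle would have two smaller neighbours.\<close>

lemma no_cycle_tree_graph:
  assumes "pre_digraph.cycle (with_proj (tree_graph t)) p" "3 \<le> length p"
  shows False
proof -
  interpret pair_graph "tree_graph t" by (rule pair_graph_tree_graph)
  let ?L = "length p"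
  obtain u where u: "awalk u p u" "distinct (tl (pawalk_verts u p))"
    using assms(1) by (auto simp: cycle_def)
  from u(1) have p: "set p \<subseteq> tree_arcs t 0" "pcas u p u"
    by (auto simp: awalk_def)
  \<comment> \<open>Targets of the arcs, indexed modulo the length, so that every vertex of the
    cycle has a predecessor and a successor.\<close>
  define x where "x i = snd (p ! (i mod ?L))" for i
  have ne: "p \<noteq> []" using assms(2) by auto
  have vs: "tl (pawalk_verts u p) = map snd p"
    using awalk_verts_conv'[of u p u] p(2) ne by simp
  have step: "(x i, x (Suc i)) \<in> tree_arcs t 0" for i
  proof -
    let ?j = "Suc i mod ?L"
    have j: "?j < ?L" using ne by simp
    have "fst (p ! ?j) = x i"
    proof (cases "?j = 0")
      \<comment> \<open>Wrap-around: the first arc starts at \<open>u\<close>, where the last one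
        ends.\<close>
      case True
      then have "i mod ?L = ?L - 1"
        using ne by (auto simp: mod_Suc split: if_splits)
      then show ?thesis
        using pcas_nth[OF p(2) j] True pcas_last[OF p(2) ne] ne by (simp add: x_def last_conv_nth)
    next
      case False
      then have "?j - 1 = i mod ?L"
        by (auto simp: mod_Suc split: if_splits)
      then show ?thesis
        using pcas_nth[OF p(2) j] False by (simp add: x_def)
    qed
    then have "(x i, x (Suc i)) = p ! ?j" by (simp add: x_def prod_eq_iff)
    then show ?thesis using p(1) j by (metis nth_mem subsetD)
  qed
  have inj: "i mod ?L = j mod ?L" if "x i = x j" for i j
  proof (rule nth_eq_iff_index_eq[THEN iffD1])
    show "distinct (map snd p)" using u(2) by (simp add: vs)
    show "map snd p ! (i mod ?L) = map snd p ! (j mod ?L)"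
      using that ne by (simp add: x_def)
  qed (use ne in auto)
  have "Max (x ` {..<?L}) \<in> x ` {..<?L}" using ne by (intro Max_in) auto
  then obtain i where i: "i < ?L" "x i = Max (x ` {..<?L})" by auto
  have le: "x j \<le> x i" for j
  proof -
    have "x j = x (j mod ?L)" by (simp add: x_def)
    moreover have "x (j mod ?L) \<le> x i" unfolding i(2) using ne by (intro Max_ge) auto
    ultimately show ?thesis by simp
  qed
  \<comment> \<open>A full turn beyond \<open>i\<close> reaches the same vertex and makes
    \<open>h - 1\<close> a genuine predecessor even for \<open>i = 0\<close>.\<close>
  define h where "h = i + ?L"
  have h: "x h = x i" by (simp add: h_def x_def)
  have "Suc (h - 1) = h" using ne by (simp add: h_def)
  then have a: "(x (h - 1), x h) \<in> tree_arcs t 0" "(x h, x (Suc h)) \<in> tree_arcs t 0"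
    using step[of "h - 1"] step[of h] by auto
  have "x (h - 1) < x h" "x (Suc h) < x h"
    using a[THEN tree_arcs_irrefl] le[of "h - 1"] le[of "Suc h"] h by auto
  then have "x (h - 1) = x (Suc h)"
    using smaller_neighbour_unique a tree_arcs_sym by blast
  then have "(h - 1) mod ?L = Suc h mod ?L" by (rule inj)
  \<comment> \<open>Two indices at distance 2 coincide modulo the length, which is impossible from
    length 3 on.\<close>
  then have "?L dvd Suc h - (h - 1)"
    using mod_eq_dvd_iff_nat[of "h - 1" "Suc h" ?L] by simp
  moreover have "Suc h - (h - 1) = 2" using \<open>Suc (h - 1) = h\<close> by linarith
  ultimately have "?L dvd 2" by simp
  then show False using assms(2) by (auto dest: dvd_imp_le)
qed

lemma undirected_tree_tree_graph: "undirected_tree (tree_graph t)"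
  unfolding undirected_tree_def
  using pair_graph_tree_graph connected_tree_graph no_cycle_tree_graph by blast

section \<open>Neighbour counts and the maximum degree\<close>

definition nbrs_in :: "nat rel \<Rightarrow> nat set \<Rightarrow> nat \<Rightarrow> nat" where
  "nbrs_in A S v = card {u \<in> S. (v, u) \<in> A}"

text \<open>The two blocks and the two orientations of the joining edge contribute disjoint sets of
  neighbours.\<close>

lemma nbrs_in_Graft:
  "nbrs_in (tree_arcs (Graft s t) n) S v =
     nbrs_in (tree_arcs s n) S v + nbrs_in (tree_arcs t (n + order s)) S v +
     of_bool (v = n \<and> n + order s \<in> S) + of_bool (v = n + order s \<and> n \<in> S)"
proof -
  let ?A = "{u \<in> S. (v, u) \<in> tree_arcs s n}" and ?B = "{u \<in> S. (v, u) \<in> tree_arcs t (n + order s)}"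
  let ?C = "{u \<in> S. v = n \<and> u = n + order s}" and ?D = "{u \<in> S. v = n + order s \<and> u = n}"
  have fin: "finite ?A" "finite ?B" "finite ?C" "finite ?D"
    by (auto intro!: finite_subset[OF _ finite_atMost[of "n + order s + order t"]]
        dest: tree_arcsD)
  have eq: "{u \<in> S. (v, u) \<in> tree_arcs (Graft s t) n} = ?A \<union> ?B \<union> ?C \<union> ?D"
    by auto
  have "nbrs_in (tree_arcs (Graft s t) n) S v = card ?A + card ?B + card ?C + card ?D"
  proof -
    have "?A \<inter> ?B = {}" "(?A \<union> ?B) \<inter> ?C = {}" "(?A \<union> ?B \<union> ?C) \<inter> ?D = {}"
      by (auto dest: tree_arcsD tree_arcs_disjoint)
    then show ?thesis
      unfolding nbrs_in_def eq using fin by (simp add: card_Un_disjoint del: Un_iff)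
  qed
  moreover have "card ?C = of_bool (v = n \<and> n + order s \<in> S)"
    by (cases "v = n \<and> n + order s \<in> S") (auto simp: Collect_conv_if)
  moreover have "card ?D = of_bool (v = n + order s \<and> n \<in> S)"
    by (cases "v = n + order s \<and> n \<in> S") (auto simp: Collect_conv_if)
  ultimately show ?thesis by (simp add: nbrs_in_def)
qed

lemma nbrs_in_outside: "v \<notin> tree_verts t n \<Longrightarrow> nbrs_in (tree_arcs t n) S v = 0"
  unfolding nbrs_in_def card_eq_0_iff by (auto dest: tree_arcsD)

lemma nbrs_in_Int: "nbrs_in (tree_arcs t n) (S \<inter> tree_verts t n) v = nbrs_in (tree_arcs t n) S v"
  unfolding nbrs_in_def by (rule arg_cong[where f = card]) (auto dest: tree_arcsD)

primrec root_degree :: "rtree \<Rightarrow> nat" where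
  "root_degree Vertex = 0"
| "root_degree (Graft s t) = Suc (root_degree s)"

text \<open>\<open>Graft\<close> adds one neighbour to each of the two roots and none elsewhere, so
  root degrees are tracked separately.\<close>

primrec tree_degree :: "rtree \<Rightarrow> nat" where
  "tree_degree Vertex = 0"
| "tree_degree (Graft s t) =
     max (max (tree_degree s) (Suc (root_degree s))) (max (tree_degree t) (Suc (root_degree t)))"

lemma nbrs_in_root: "nbrs_in (tree_arcs t n) UNIV n = root_degree t"
  by (induction t arbitrary: n)
    (simp add: nbrs_in_def, simp add: nbrs_in_Graft nbrs_in_outside del: tree_arcs.simps)

lemma nbrs_in_le_tree_degree: "nbrs_in (tree_arcs t n) UNIV v \<le> tree_degree t"
proof (induction t arbitrary: n)
  case (Graft s t)
  show ?case
  proof (cases "v < n + order s")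
    case True
    then show ?thesis
      using Graft(1)[of n]
      by (cases "v = n") (auto simp: nbrs_in_Graft nbrs_in_outside nbrs_in_root simp del: tree_arcs.simps)
  next
    case False
    then show ?thesis
      using Graft(2)[of "n + order s"]
      by (cases "v = n + order s")
        (auto simp: nbrs_in_Graft nbrs_in_outside nbrs_in_root simp del: tree_arcs.simps)
  qed
qed (simp add: nbrs_in_def)

lemma tree_degree_attained:
  "\<exists>v \<in> tree_verts t n. tree_degree t \<le> nbrs_in (tree_arcs t n) UNIV v"
proof (induction t arbitrary: n)
  case (Graft s t)
  obtain v where v: "v \<in> tree_verts s n" "tree_degree s \<le> nbrs_in (tree_arcs s n) UNIV v"
    using Graft(1) by blast
  obtain w where w: "w \<in> tree_verts t (n + order s)"
      "tree_degree t \<le> nbrs_in (tree_arcs t (n + order s)) UNIV w"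
    using Graft(2) by blast
  let ?d = "nbrs_in (tree_arcs (Graft s t) n) UNIV"
  have "tree_degree s \<le> ?d v" "tree_degree t \<le> ?d w"
    using v(2) w(2) by (simp_all add: nbrs_in_Graft del: tree_arcs.simps)
  moreover have "Suc (root_degree s) \<le> ?d n" "Suc (root_degree t) \<le> ?d (n + order s)"
    by (simp_all add: nbrs_in_Graft nbrs_in_root del: tree_arcs.simps)
  moreover have "{v, w, n, n + order s} \<subseteq> tree_verts (Graft s t) n"
    using v(1) w(1) by auto
  ultimately show ?case
    by (auto simp: max_def simp del: tree_arcs.simps)
qed simp

lemma max_degree_tree_graph: "max_degree (tree_graph t) = tree_degree t"
proof -
  have deg: "out_degree (with_proj (tree_graph t)) v = nbrs_in (tree_arcs t 0) UNIV v" for v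
  proof -
    have "out_arcs (with_proj (tree_graph t)) v = Pair v ` {u \<in> UNIV. (v, u) \<in> tree_arcs t 0}"
      by (auto simp: out_arcs_def)
    then show ?thesis
      by (simp add: out_degree_def nbrs_in_def card_image inj_on_def)
  qed
  obtain v where "v \<in> tree_verts t 0" "nbrs_in (tree_arcs t 0) UNIV v = tree_degree t"
    using tree_degree_attained[of 0 t] nbrs_in_le_tree_degree[of t 0] le_antisym by blast
  then have "tree_degree t \<in> nbrs_in (tree_arcs t 0) UNIV ` tree_verts t 0"
    by (metis imageI)
  then show ?thesis
    unfolding max_degree_def deg
    by (intro Max_eqI) (auto intro: nbrs_in_le_tree_degree)
qed

section \<open>Dynamic programming for quasiperfect domination\<close>

text \<open>
  \<open>conf k t b j m\<close>: some set \<open>S\<close> of \<open>m\<close> vertices is \<open>k\<close>-quasiperfect dominating except possibly at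
  the root, the root has \<open>j\<close> neighbours in \<open>S\<close>, and \<open>b\<close> says whether the root lies in \<open>S\<close>.
  See \<open>conf_iff\<close>.
\<close>

primrec conf :: "nat \<Rightarrow> rtree \<Rightarrow> bool \<Rightarrow> nat \<Rightarrow> nat \<Rightarrow> bool" where
  "conf k Vertex b j m \<longleftrightarrow> j = 0 \<and> m = of_bool b"
| "conf k (Graft s t) b j m \<longleftrightarrow>
     (\<exists>j1 m1 b2 j2 m2. conf k s b j1 m1 \<and> conf k t b2 j2 m2 \<and>
        (b2 \<or> j2 + of_bool b \<in> {1..k}) \<and> j = j1 + of_bool b2 \<and> m = m1 + m2)"

text \<open>The root is exempt from both bounds since a later \<open>Graft\<close> can still change
  its number of dominators.\<close>

definition near_dominating :: "nat \<Rightarrow> rtree \<Rightarrow> nat \<Rightarrow> nat set \<Rightarrow> bool" where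
  "near_dominating k t n S \<longleftrightarrow>
     S \<subseteq> tree_verts t n \<and> (\<forall>v \<in> tree_verts t n - S - {n}. nbrs_in (tree_arcs t n) S v \<in> {1..k})"

text \<open>The joining edge changes counts only at its ends. The root \<open>r\<close> of
  \<open>t\<close> receives its parent, so its condition must now be settled; \<open>n\<close> stays
  exempt.\<close>

lemma near_dominating_Graft:
  assumes r_def: "r = n + order s"
    and "S1 \<subseteq> tree_verts s n" "S2 \<subseteq> tree_verts t r"
  shows "near_dominating k (Graft s t) n (S1 \<union> S2) \<longleftrightarrow>
    near_dominating k s n S1 \<and> near_dominating k t r S2 \<and>
    (r \<in> S2 \<or> nbrs_in (tree_arcs t r) S2 r + of_bool (n \<in> S1) \<in> {1..k})"
    "nbrs_in (tree_arcs (Graft s t) n) (S1 \<union> S2) n = nbrs_in (tree_arcs s n) S1 n + of_bool (r \<in> S2)"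
proof -
  let ?S = "S1 \<union> S2" and ?A = "tree_arcs (Graft s t) n"
  have pos: "order s \<noteq> 0" "order t \<noteq> 0" by simp_all
  have S: "?S \<inter> tree_verts s n = S1" "?S \<inter> tree_verts t r = S2"
    using assms by auto
  have 1: "nbrs_in (tree_arcs s n) ?S v = nbrs_in (tree_arcs s n) S1 v" for v
    by (metis S(1) nbrs_in_Int)
  have 2: "nbrs_in (tree_arcs t r) ?S v = nbrs_in (tree_arcs t r) S2 v" for v
    by (metis S(2) nbrs_in_Int)
  have mem: "r \<in> ?S \<longleftrightarrow> r \<in> S2" "n \<in> ?S \<longleftrightarrow> n \<in> S1"
    using assms(2,3) pos unfolding r_def by fastforce+
  have A1: "nbrs_in ?A ?S v = nbrs_in (tree_arcs s n) S1 v + of_bool (v = n \<and> r \<in> S2)"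
    if "v \<in> tree_verts s n" for v
    using that unfolding nbrs_in_Graft r_def[symmetric] 1 2 mem
    by (auto simp: nbrs_in_outside r_def)
  have A2: "nbrs_in ?A ?S v = nbrs_in (tree_arcs t r) S2 v + of_bool (v = r \<and> n \<in> S1)"
    if "v \<in> tree_verts t r" for v
    using that pos unfolding nbrs_in_Graft r_def[symmetric] 1 2 mem
    by (auto simp: nbrs_in_outside r_def)
  show "nbrs_in ?A ?S n = nbrs_in (tree_arcs s n) S1 n + of_bool (r \<in> S2)"
    using A1[of n] by simp
  have split: "tree_verts (Graft s t) n - ?S - {n} =
      (tree_verts s n - S1 - {n}) \<union> (tree_verts t r - S2 - {r}) \<union> ({r} - S2)"
    using assms pos by (auto simp: r_def)
  have sub: "?S \<subseteq> tree_verts (Graft s t) n"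
    using assms by auto
  have "(\<forall>v \<in> tree_verts s n - S1 - {n}. nbrs_in ?A ?S v \<in> {1..k}) \<longleftrightarrow> near_dominating k s n S1"
    using assms(2) unfolding near_dominating_def by (auto simp: A1 simp del: tree_arcs.simps)
  moreover have "(\<forall>v \<in> tree_verts t r - S2 - {r}. nbrs_in ?A ?S v \<in> {1..k}) \<longleftrightarrow> near_dominating k t r S2"
    using assms(3) unfolding near_dominating_def by (auto simp: A2 simp del: tree_arcs.simps)
  moreover have "nbrs_in ?A ?S r = nbrs_in (tree_arcs t r) S2 r + of_bool (n \<in> S1)"
    using A2[of r] by (simp del: tree_arcs.simps)
  moreover have "near_dominating k (Graft s t) n ?S \<longleftrightarrow>
      (\<forall>v \<in> (tree_verts s n - S1 - {n}) \<union> (tree_verts t r - S2 - {r}) \<union> ({r} - S2). nbrs_in ?A ?S v \<in> {1..k})"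
    unfolding near_dominating_def split using sub by simp
  ultimately show "near_dominating k (Graft s t) n ?S \<longleftrightarrow>
    near_dominating k s n S1 \<and> near_dominating k t r S2 \<and>
    (r \<in> S2 \<or> nbrs_in (tree_arcs t r) S2 r + of_bool (n \<in> S1) \<in> {1..k})"
    unfolding ball_Un by auto
qed

text \<open>Cutting a set at the joining edge and uniting sets of the two blocks are inverse to each
  other, which matches the recursion of \<open>conf\<close>.\<close>

lemma conf_iff:
  "conf k t b j m \<longleftrightarrow> (\<exists>S. near_dominating k t n S \<and> card S = m \<and> (n \<in> S \<longleftrightarrow> b) \<and>
     nbrs_in (tree_arcs t n) S n = j)"
proof (induction t arbitrary: n b j m)
  case Vertex
  have *: "near_dominating k Vertex n S \<longleftrightarrow> S = {} \<or> S = {n}" for S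
    by (auto simp: near_dominating_def)
  have "(\<exists>S. near_dominating k Vertex n S \<and> P S) \<longleftrightarrow> P {} \<or> P {n}" for P
    unfolding * by (simp add: conj_disj_distribR ex_disj_distrib)
  then show ?case
    by (cases b) (auto simp: nbrs_in_def)
next
  case (Graft s t)
  define r where "r = n + order s"
  note IH = Graft(1)[of _ _ _ n] Graft(2)[of _ _ _ r]
  have card_un: "card (X \<union> Y) = card X + card Y"
    if "X \<subseteq> tree_verts s n" "Y \<subseteq> tree_verts t r" for X Y
  proof (rule card_Un_disjoint)
    show "finite X" using that(1) by (rule finite_subset) simp
    show "finite Y" using that(2) by (rule finite_subset) simp
    have "tree_verts s n \<inter> tree_verts t r = {}" by (auto simp: r_def)
    then show "X \<inter> Y = {}" using that by blast
  qed
  have pos: "order s \<noteq> 0" by simp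
  note G = near_dominating_Graft[OF r_def]
  show ?case
  proof
    assume "conf k (Graft s t) b j m"
    then obtain j1 m1 b2 j2 m2 where c: "conf k s b j1 m1" "conf k t b2 j2 m2"
      "b2 \<or> j2 + of_bool b \<in> {1..k}" "j = j1 + of_bool b2" "m = m1 + m2" by auto
    obtain S1 where S1: "near_dominating k s n S1" "card S1 = m1" "n \<in> S1 \<longleftrightarrow> b"
      "nbrs_in (tree_arcs s n) S1 n = j1" using c(1) IH(1) by blast
    obtain S2 where S2: "near_dominating k t r S2" "card S2 = m2" "r \<in> S2 \<longleftrightarrow> b2"
      "nbrs_in (tree_arcs t r) S2 r = j2" using c(2) IH(2) by blast
    have sub: "S1 \<subseteq> tree_verts s n" "S2 \<subseteq> tree_verts t r"
      using S1(1) S2(1) by (auto simp: near_dominating_def)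
    have "card (S1 \<union> S2) = m"
      using card_un[OF sub] S1(2) S2(2) c(5) by simp
    moreover have "n \<in> S1 \<union> S2 \<longleftrightarrow> b"
      using S1(3) sub(2) pos by (auto simp: r_def)
    moreover have "near_dominating k (Graft s t) n (S1 \<union> S2)"
      using G(1)[OF sub] S1 S2 c(3) by auto
    moreover have "nbrs_in (tree_arcs (Graft s t) n) (S1 \<union> S2) n = j"
      using G(2)[OF sub] S1(4) S2(3) c(4) by simp
    ultimately show "\<exists>S. near_dominating k (Graft s t) n S \<and> card S = m \<and> (n \<in> S \<longleftrightarrow> b) \<and>
      nbrs_in (tree_arcs (Graft s t) n) S n = j" by blast
  next
    assume "\<exists>S. near_dominating k (Graft s t) n S \<and> card S = m \<and> (n \<in> S \<longleftrightarrow> b) \<and>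
      nbrs_in (tree_arcs (Graft s t) n) S n = j"
    then obtain S where S: "near_dominating k (Graft s t) n S" "card S = m" "n \<in> S \<longleftrightarrow> b"
      "nbrs_in (tree_arcs (Graft s t) n) S n = j" by blast
    define S1 S2 where "S1 = S \<inter> tree_verts s n" and "S2 = S \<inter> tree_verts t r"
    have sub: "S1 \<subseteq> tree_verts s n" "S2 \<subseteq> tree_verts t r" by (auto simp: S1_def S2_def)
    have un: "S = S1 \<union> S2"
      using S(1) by (auto simp: near_dominating_def S1_def S2_def r_def)
    have n1: "n \<in> S1 \<longleftrightarrow> b" using S(3) by (auto simp: S1_def)
    have card: "m = card S1 + card S2"
      using card_un[OF sub] S(2) un by simp
    have nd: "near_dominating k s n S1" "near_dominating k t r S2"
      "r \<in> S2 \<or> nbrs_in (tree_arcs t r) S2 r + of_bool b \<in> {1..k}"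
      using G(1)[OF sub] S(1) n1 unfolding un by auto
    have "conf k s b (nbrs_in (tree_arcs s n) S1 n) (card S1)"
      using IH(1) nd(1) n1 by blast
    moreover have "conf k t (r \<in> S2) (nbrs_in (tree_arcs t r) S2 r) (card S2)"
      using IH(2) nd(2) by blast
    moreover have "j = nbrs_in (tree_arcs s n) S1 n + of_bool (r \<in> S2)"
      using G(2)[OF sub] S(4) un by simp
    ultimately show "conf k (Graft s t) b j m"
      unfolding conf.simps using nd(3) card by blast
  qed
qed

lemma quasiperfect_dominating_set_tree_graph:
  "quasiperfect_dominating_set k (tree_graph t) S \<longleftrightarrow>
     near_dominating k t 0 S \<and> (0 \<in> S \<or> nbrs_in (tree_arcs t 0) S 0 \<in> {1..k})"
proof -
  have "(\<exists>u \<in> S. (v, u) \<in> tree_arcs t 0) \<longleftrightarrow> 1 \<le> nbrs_in (tree_arcs t 0) S v" for v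
  proof -
    have "finite {u \<in> S. (v, u) \<in> tree_arcs t 0}"
      by (rule finite_subset[of _ "tree_verts t 0"]) (auto dest: tree_arcsD)
    then show ?thesis
      unfolding nbrs_in_def Suc_le_eq One_nat_def card_gt_0_iff by blast
  qed
  then have "quasiperfect_dominating_set k (tree_graph t) S \<longleftrightarrow>
      S \<subseteq> tree_verts t 0 \<and> (\<forall>v \<in> tree_verts t 0 - S. nbrs_in (tree_arcs t 0) S v \<in> {1..k})"
    unfolding quasiperfect_dominating_set_def dominating_set_def nbrs_in_def[symmetric]
    by (auto simp: nbrs_in_def[symmetric])
  moreover have "0 \<in> tree_verts t 0" by simp
  ultimately show ?thesis
    unfolding near_dominating_def by blast
qed

text \<open>With \<open>k\<close> the maximum degree, the upper bound on dominators holds for every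
  set.\<close>

lemma domination_number_tree_graph:
  "domination_number (tree_graph t) = quasiperfect_domination_number (tree_degree t) (tree_graph t)"
proof -
  have "card {u \<in> S. (v, u) \<in> tree_arcs t 0} \<le> tree_degree t" for S v
  proof -
    have "finite {u \<in> UNIV. (v, u) \<in> tree_arcs t 0}"
      by (rule finite_subset[of _ "tree_verts t 0"]) (auto dest: tree_arcsD)
    then have "card {u \<in> S. (v, u) \<in> tree_arcs t 0} \<le> card {u \<in> UNIV. (v, u) \<in> tree_arcs t 0}"
      by (rule card_mono) auto
    then show ?thesis
      using nbrs_in_le_tree_degree[of t 0 v] by (simp add: nbrs_in_def)
  qed
  then have "dominating_set (tree_graph t) S \<longleftrightarrow>
      quasiperfect_dominating_set (tree_degree t) (tree_graph t) S" for S
    by (simp add: quasiperfect_dominating_set_def)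
  then show ?thesis
    by (simp add: domination_number_def quasiperfect_domination_number_def)
qed

section \<open>Costs that add up when trees are attached\<close>

text \<open>
  With the extra cost \<open>of_bool b\<close>, an attached part gains nothing from the root of \<open>t\<close>, nor does \<open>t\<close>
  gain from being relieved of dominating its root; hence costs add up along \<open>extend\<close>.
\<close>

definition attachable :: "nat \<Rightarrow> rtree \<Rightarrow> nat \<Rightarrow> bool" where
  "attachable k t f \<longleftrightarrow> (\<forall>b j m. conf k t b j m \<longrightarrow> f + of_bool b \<le> m) \<and> conf k t False 1 f"

text \<open>The lower bound in \<open>attachable\<close> covers in particular the sets that also
  dominate the root, and its witness gives the root exactly one dominator, admissible for all
  \<open>k \<ge> 1\<close>.\<close>

lemma quasiperfect_domination_number_attachable:
  assumes "attachable k t f" "1 \<le> k"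
  shows "quasiperfect_domination_number k (tree_graph t) = f"
  unfolding quasiperfect_domination_number_def
proof (rule Least_equality)
  have "conf k t False 1 f" using assms(1) by (simp add: attachable_def)
  then obtain S where "near_dominating k t 0 S" "card S = f" "nbrs_in (tree_arcs t 0) S 0 = 1"
    using conf_iff[of k t _ _ _ 0] by blast
  then show "\<exists>S. quasiperfect_dominating_set k (tree_graph t) S \<and> card S = f"
    using assms(2) by (auto simp: quasiperfect_dominating_set_tree_graph)
next
  fix m assume "\<exists>S. quasiperfect_dominating_set k (tree_graph t) S \<and> card S = m"
  then obtain S where "near_dominating k t 0 S" "card S = m"
    by (auto simp: quasiperfect_dominating_set_tree_graph)
  then have "conf k t (0 \<in> S) (nbrs_in (tree_arcs t 0) S 0) m"
    using conf_iff[of k t _ _ _ 0] by blast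
  then have "f + of_bool (0 \<in> S) \<le> m"
    using assms(1) unfolding attachable_def by blast
  then show "f \<le> m" by simp
qed

lemma conf_GraftI:
  assumes "conf k s b i p" "conf k t c h q" "c \<or> h + of_bool b \<in> {1..k}"
    "j = i + of_bool c" "m = p + q"
  shows "conf k (Graft s t) b j m"
  using assms unfolding conf.simps by blast

lemma conf_Graft_VertexE:
  assumes "conf k (Graft Vertex t) b j m"
  obtains c h q where "conf k t c h q" "c \<or> h + of_bool b \<in> {1..k}" "j = of_bool c"
    "m = of_bool b + q"
  using assms unfolding conf.simps by (elim exE conjE) (rule that, assumption+, simp_all)

section \<open>The gadgets and their costs\<close>

definition cherry :: rtree where
  "cherry = Graft (Graft Vertex Vertex) Vertex"

text \<open>The root is the vertex \<open>w\<close> with \<open>e\<close> of its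
  \<open>e + 1\<close> supports; the last one is the root of \<open>support e\<close>.\<close>

definition hub :: "nat \<Rightarrow> rtree" where
  "hub e = ((\<lambda>t. Graft t cherry) ^^ e) Vertex"

definition support :: "nat \<Rightarrow> rtree" where
  "support e = Graft (Graft Vertex Vertex) (hub e)"

definition pendant :: "nat \<Rightarrow> rtree" where
  "pendant e = Graft Vertex (Graft Vertex (support e))"

text \<open>
  The supports in \<open>pendant e\<close> are the root of \<open>support e\<close> and the \<open>e\<close> cherries of the hub. The spine
  vertex is the child of the root of \<open>extend t e\<close>; paths of length three join it to the support and to
  the previous spine vertex, so only hubs and the star can have degree above \<open>3\<close>.
\<close>

definition extend :: "rtree \<Rightarrow> nat \<Rightarrow> rtree" where
  "extend t e = Graft Vertex (Graft (Graft Vertex (Graft Vertex t)) (pendant e))"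

text \<open>Rooted at one of its \<open>d + 1\<close> leaves, so that the root has degree 1 like
  that of \<open>extend\<close>.\<close>

definition star :: "nat \<Rightarrow> rtree" where
  "star d = Graft Vertex (((\<lambda>t. Graft t Vertex) ^^ d) Vertex)"

lemma conf_cherry_ge: "conf k cherry b j m \<Longrightarrow> 2 - of_bool b \<le> m"
  by (auto simp: cherry_def of_bool_def split: if_splits)

lemma conf_cherry: "1 \<le> k \<Longrightarrow> conf k cherry True 0 1"
  by (auto simp: cherry_def)

text \<open>A cherry with unchosen centre needs both leaves, at cost 2; a chosen centre costs at
  least 1 and counts towards \<open>j\<close>. So each dominator missing at the hub costs one more
  vertex.\<close>

lemma conf_hub_ge:
  "conf k (hub e) b j m \<Longrightarrow> e + of_bool b \<le> m \<and> 2 * e \<le> m + j"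
proof (induction e arbitrary: j m)
  case (Suc e)
  then obtain j1 m1 b2 j2 m2 where *: "conf k (hub e) b j1 m1" "conf k cherry b2 j2 m2"
    "j = j1 + of_bool b2" "m = m1 + m2"
    by (auto simp: hub_def)
  show ?case
    using Suc.IH[OF *(1)] conf_cherry_ge[OF *(2)] *(3,4) by (cases b2) auto
qed (simp add: hub_def)

lemma conf_hub:
  "1 \<le> k \<Longrightarrow> conf k (hub e) b e (e + of_bool b)"
proof (induction e)
  case (Suc e)
  have "hub (Suc e) = Graft (hub e) cherry" by (simp add: hub_def)
  then show ?case
    using Suc conf_GraftI[OF _ conf_cherry] by simp
qed (simp add: hub_def)

text \<open>The root or its leaf costs 1. If the root is chosen and the hub is not, at most
  \<open>k - 1\<close> cherry centres are chosen, so for \<open>k \<le> e\<close> the hub part costs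
  at least \<open>e + 1\<close>; a chosen hub costs at least that too.\<close>

lemma conf_support_ge:
  assumes "conf k (support e) b j m"
  shows "e + 1 + of_bool (b \<and> k \<le> e) \<le> m"
proof -
  obtain j1 m1 b2 j2 m2 where *: "conf k (Graft Vertex Vertex) b j1 m1" "conf k (hub e) b2 j2 m2"
    "b2 \<or> j2 + of_bool b \<in> {1..k}" "m = m1 + m2"
    using assms unfolding support_def conf.simps(2)[of _ "Graft Vertex Vertex"] by blast
  have "1 \<le> m1" using *(1) by (auto simp: of_bool_def split: if_splits)
  then show ?thesis
    using conf_hub_ge[OF *(2)] *(3,4) by (cases b; cases b2) auto
qed

lemma conf_support:
  assumes "1 \<le> k"
  shows "\<exists>j. conf k (support e) True j (e + 1 + of_bool (k \<le> e))"
proof -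
  have "conf k (Graft Vertex Vertex) True 0 1"
    by (rule conf_GraftI[where c = False]) (use assms in auto)
  \<comment> \<open>The hub is chosen exactly when \<open>k \<le> e\<close>; otherwise its
    \<open>e + 1\<close> dominators are allowed.\<close>
  then have "conf k (support e) True (of_bool (k \<le> e)) (e + 1 + of_bool (k \<le> e))"
    unfolding support_def by (rule conf_GraftI[OF _ conf_hub[OF assms, where b = "k \<le> e"]]) auto
  then show ?thesis by blast
qed

text \<open>If the support is not chosen, the vertex above it must be chosen or dominated by the
  root of the pendant; either costs the same extra vertex.\<close>

lemma conf_pendant_ge:
  assumes "conf k (pendant e) b j m"
  shows "e + 1 + of_bool (k \<le> e) \<le> m"
proof -
  obtain b2 j2 m2 where 1: "conf k (Graft Vertex (support e)) b2 j2 m2"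
    "b2 \<or> j2 + of_bool b \<in> {1..k}" "m = of_bool b + m2"
    using assms unfolding pendant_def by (rule conf_Graft_VertexE)
  obtain b3 j3 m3 where 2: "conf k (support e) b3 j3 m3"
    "b3 \<or> j3 + of_bool b2 \<in> {1..k}" "j2 = of_bool b3" "m2 = of_bool b2 + m3"
    using 1(1) by (rule conf_Graft_VertexE)
  show ?thesis
    using conf_support_ge[OF 2(1)] 1(2,3) 2(3,4) by (cases b; cases b2; cases b3) auto
qed

text \<open>The root is left undominated: in \<open>extend\<close> the spine vertex becomes its only
  dominator.\<close>

lemma conf_pendant:
  assumes "1 \<le> k"
  shows "conf k (pendant e) False 0 (e + 1 + of_bool (k \<le> e))"
proof -
  obtain j where j: "conf k (support e) True j (e + 1 + of_bool (k \<le> e))"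
    using conf_support[OF assms] by blast
  have "conf k (Graft Vertex (support e)) False 1 (e + 1 + of_bool (k \<le> e))"
    by (rule conf_GraftI[OF _ j]) auto
  then show ?thesis
    unfolding pendant_def by (rule conf_GraftI[rotated]) (use assms in auto)
qed

text \<open>Besides the shares of \<open>t\<close> and the pendant, the vertex between the spine
  vertex and \<open>t\<close> must be dominated, by itself, the spine vertex or the root of
  \<open>t\<close>. Each costs 1 more, the last through \<open>of_bool b\<close> in
  \<open>attachable\<close>.\<close>

lemma attachable_extend:
  assumes "attachable k t f" "1 \<le> k"
  shows "attachable k (extend t e) (f + (e + 2 + of_bool (k \<le> e)))"
proof -
  define g where "g = e + 1 + of_bool (k \<le> e)"
  have t: "f + of_bool b \<le> m" if "conf k t b j m" for b j m
    using assms(1) that by (auto simp: attachable_def)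
  have "f + g + 1 + of_bool b \<le> m" if c: "conf k (extend t e) b j m" for b j m
  proof -
    obtain bc jc mc where 1: "conf k (Graft (Graft Vertex (Graft Vertex t)) (pendant e)) bc jc mc"
      "m = of_bool b + mc"
      using c unfolding extend_def by (rule conf_Graft_VertexE)
    then obtain j1 m1 b2 j2 m2 where 2: "conf k (Graft Vertex (Graft Vertex t)) bc j1 m1"
      "conf k (pendant e) b2 j2 m2" "mc = m1 + m2"
      unfolding conf.simps(2)[of _ "Graft Vertex (Graft Vertex t)"] by blast
    obtain b3 j3 m3 where 3: "conf k (Graft Vertex t) b3 j3 m3" "b3 \<or> j3 + of_bool bc \<in> {1..k}"
      "m1 = of_bool bc + m3"
      using 2(1) by (rule conf_Graft_VertexE)
    obtain b4 j4 m4 where 4: "conf k t b4 j4 m4" "j3 = of_bool b4" "m3 = of_bool b3 + m4"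
      using 3(1) by (rule conf_Graft_VertexE)
    show ?thesis
      using t[OF 4(1)] conf_pendant_ge[OF 2(2)] 1(2) 2(3) 3(2,3) 4(2,3)
      by (cases bc; cases b3; cases b4) (auto simp: g_def)
  qed
  \<comment> \<open>Adding only the spine vertex to the optimal parts gives the new root, the
    connecting vertex and the root of the pendant one dominator each.\<close>
  moreover have "conf k (extend t e) False 1 (f + g + 1)"
  proof -
    have "conf k t False 1 f" using assms(1) by (simp add: attachable_def)
    then have "conf k (Graft Vertex t) False 0 f"
      by (rule conf_GraftI[rotated]) (use assms in auto)
    then have "conf k (Graft Vertex (Graft Vertex t)) True 0 (f + 1)"
      by (rule conf_GraftI[rotated]) (use assms in auto)
    then have "conf k (Graft (Graft Vertex (Graft Vertex t)) (pendant e)) True 0 (f + g + 1)"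
      by (rule conf_GraftI[OF _ conf_pendant]) (use assms in \<open>auto simp: g_def\<close>)
    then show ?thesis
      unfolding extend_def by (rule conf_GraftI[rotated]) auto
  qed
  ultimately show ?thesis
    unfolding attachable_def by (simp add: g_def)
qed

lemma attachable_star:
  assumes "1 \<le> d" "1 \<le> k"
  shows "attachable k (star d) 1"
proof -
  let ?c = "\<lambda>d. ((\<lambda>t. Graft t Vertex) ^^ d) Vertex"
  \<comment> \<open>Since \<open>1 \<le> d\<close>, some leaf child must be dominated by itself or
    by the centre.\<close>
  have lower: "1 \<le> m" if "conf k (?c d) b j m" for b j m
  proof -
    obtain d' where "d = Suc d'" using assms(1) by (cases d) auto
    moreover have "of_bool b \<le> m" if "conf k (?c d') b j m" for b j m d'
      using that by (induction d' arbitrary: j m) fastforce+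
    ultimately show ?thesis
      using that by (fastforce simp: of_bool_def split: if_splits)
  qed
  have "conf k (?c d) True 0 1" for d
  proof (induction d)
    case (Suc d)
    then show ?case
      unfolding funpow.simps o_apply
      by (rule conf_GraftI[where c = False]) (use assms(2) in auto)
  qed simp
  then have "conf k (star d) False 1 1"
    unfolding star_def by (rule conf_GraftI[rotated]) auto
  moreover have "1 + of_bool b \<le> m" if c: "conf k (star d) b j m" for b j m
  proof -
    obtain b' j' m' where "conf k (?c d) b' j' m'" "m = of_bool b + m'"
      using c unfolding star_def by (rule conf_Graft_VertexE)
    then show ?thesis using lower by fastforce
  qed
  ultimately show ?thesis
    unfolding attachable_def by blast
qed

lemma attachable_foldl_extend:
  assumes "attachable k t f" "1 \<le> k"
  shows "attachable k (foldl extend t es) (f + (\<Sum>e\<leftarrow>es. e + 2 + of_bool (k \<le> e)))"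
  using assms
proof (induction es arbitrary: t f)
  case (Cons e es)
  from Cons.IH[OF attachable_extend[OF Cons.prems] Cons.prems(2)] show ?case
    by (simp add: add.assoc)
qed simp

section \<open>Degrees in the construction\<close>

lemma degree_hub: "root_degree (hub e) = e" "tree_degree (hub e) \<le> max 3 e"
  by (induction e) (auto simp: hub_def cherry_def)

text \<open>A hub joined to its support has degree \<open>e + 1 \<le> d\<close>; the other new
  vertices have degree at most 3, and the root of \<open>t\<close> rises only to 2.\<close>

lemma tree_degree_extend:
  assumes "root_degree t = 1" "tree_degree t = d" "3 \<le> d" "e < d"
  shows "root_degree (extend t e) = 1" "tree_degree (extend t e) = d"
  using degree_hub[of e] assms by (auto simp: extend_def pendant_def support_def)

lemma tree_degree_star:
  "root_degree (star d) = 1" "tree_degree (star d) = Suc d"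
proof -
  let ?c = "\<lambda>d. ((\<lambda>t. Graft t Vertex) ^^ d) Vertex"
  have *: "root_degree (?c d) = d" "tree_degree (?c d) = d" for d
    by (induction d) auto
  show "root_degree (star d) = 1" "tree_degree (star d) = Suc d"
    by (auto simp: star_def *)
qed

lemma tree_degree_foldl_extend:
  assumes "root_degree t = 1" "tree_degree t = d" "3 \<le> d" "\<forall>e \<in> set es. e < d"
  shows "tree_degree (foldl extend t es) = d"
  using assms
  by (induction es arbitrary: t) (auto simp: tree_degree_extend)

section \<open>Choosing the gadgets for a given pattern of symbols\<close>

theorem theorem4:
  fixes \<Delta> :: nat and R :: "nat \<Rightarrow> nat \<Rightarrow> nat \<Rightarrow> bool"
  assumes "\<Delta> \<ge> 3"
    and "\<forall>i \<in> {1..\<Delta> - 1}. R i \<in> {(=), (>)}"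
  shows "\<exists>T :: nat pair_pre_digraph.
    undirected_tree T \<and> max_degree T = \<Delta> \<and>
    (\<forall>i \<in> {1..\<Delta> - 1}.
       R i (quasiperfect_domination_number i T) (quasiperfect_domination_number (i + 1) T)) \<and>
    quasiperfect_domination_number \<Delta> T = domination_number T"
proof -
  \<comment> \<open>Gadget \<open>e\<close> is used exactly when the step from index
    \<open>e\<close> to \<open>e + 1\<close> has to be strict.\<close>
  define es where "es = filter (\<lambda>i. R i = (>)) [1..<\<Delta>]"
  \<comment> \<open>The centre of \<open>star d\<close> has degree \<open>d + 1\<close>, hence the
    argument \<open>\<Delta> - 1\<close>.\<close>
  define t where "t = foldl extend (star (\<Delta> - 1)) es"
  define c where "c k = (\<Sum>e\<leftarrow>es. e + 2 + of_bool (k \<le> e))" for k :: nat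
  have deg: "tree_degree t = \<Delta>"
    unfolding t_def
    by (rule tree_degree_foldl_extend) (use assms(1) in \<open>auto simp: tree_degree_star es_def\<close>)
  have num: "quasiperfect_domination_number k (tree_graph t) = 1 + c k" if "1 \<le> k" for k
    unfolding t_def c_def using assms(1) that
    by (intro quasiperfect_domination_number_attachable attachable_foldl_extend attachable_star) auto
  have step: "c i = c (i + 1) + of_bool (i \<in> set es)" for i
  proof -
    have "distinct es" by (simp add: es_def)
    then have c: "c k = (\<Sum>e\<in>set es. e + 2 + of_bool (k \<le> e))" for k
      by (simp add: c_def sum_list_distinct_conv_sum_set)
    \<comment> \<open>The summands for \<open>i\<close> and \<open>i + 1\<close> differ only at
      \<open>e = i\<close>, where \<open>i \<le> e\<close> holds but \<open>i + 1 \<le> e\<close>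
      fails.\<close>
    have "c i = (\<Sum>e\<in>set es. (e + 2 + of_bool (i + 1 \<le> e)) + (if e = i then 1 else 0))"
      unfolding c by (rule sum.cong) auto
    also have "\<dots> = c (i + 1) + of_bool (i \<in> set es)"
      unfolding sum.distrib[of _ "\<lambda>e. if e = i then 1 else 0"] c by simp
    finally show ?thesis .
  qed
  have "R i (quasiperfect_domination_number i (tree_graph t))
      (quasiperfect_domination_number (i + 1) (tree_graph t))" if i: "i \<in> {1..\<Delta> - 1}" for i
  proof -
    have "i \<in> set es \<longleftrightarrow> R i = (>)" using i by (auto simp: es_def)
    moreover have "R i = (=) \<or> R i = (>)"
      using assms(2) i by simp
    \<comment> \<open>This ensures that \<open>R i = (=)\<close> keeps \<open>i\<close> out of
      \<open>es\<close>.\<close>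
    moreover have "((=) :: nat \<Rightarrow> nat \<Rightarrow> bool) \<noteq> (>)"
      by (metis less_irrefl)
    ultimately show ?thesis
      using i num[of i] num[of "i + 1"] step[of i] by (elim disjE) simp_all
  qed
  then show ?thesis
    using undirected_tree_tree_graph max_degree_tree_graph[of t] domination_number_tree_graph[of t] deg
    by metis
qed

end
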